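(* Let $k\ge1$, $t\ge0$, $R=2^t$, $1\le q\le k$, $N\ge0$, and assume $d=2RN+(q+1)R$. The rank of the family of all columns $\mathrm{Sq}^R(g(A;J))$, with $J$ ranging over the $q$-element subsets of $\{1,\dots,k\}$ and $A$ over the weak compositions of $N$ into $k$ parts, is $$B_{t,q}(k,d)=\sum_{s=q}^{\min(k,N+q)}\binom{s-1}{q-1}\binom ks\binom{N+q-1}{s-1}.$$ For $q\ge2$, this family contains a subfamily with acyclic bipartite incidence graph of size $$H_{t,q}(k,d)=\sum_{s=q}^{\min(k,N+q)}(s-q+1)\binom ks\binom{N+q-1}{s-1}.$$
   Context: $\mathbb N$ includes $0$. $\mathcal P_k=\mathbb F_2[x_1,\dots,x_k]$ with $\deg x_i=1$. For $e\in\mathbb N^k$, $x^e=\prod x_i^{e_i}$, $|e|=\sum e_i$. Steenrod squares act linearly by $\mathrm{Sq}^r(x^a)=\sum_{b\in\mathbb N^k,|b|=r}\prod_i\binom{a_i}{b_i}x^{a+b}$ (mod 2). A weak composition of $N$ into $k$ parts is $A=(a_1,\dots,a_k)\in\mathbb N^k$ with $|A|=N$. With $m=2R$, for a $q$-element set $J\subseteq\{1,\dots,k\}$ and a weak composition $A$ of $N$, $$g(A;J)=\prod_{j\in J}x_j^{ma_j+R}\prod_{j\notin J}x_j^{ma_j},$$ a monomial of degree $d-R$. The columns $\mathrm{Sq}^R(g(A;J))$ are regarded as vectors in the space of degree-$d$ polynomials with monomial basis (rows); the rank of the family is the dimension of its span. The bipartite incidence graph of a family of columns has as vertices the columns and the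 degree-$d$ monomials, with an edge when the monomial occurs in the column with coefficient one; acyclic means it is a forest. (By convention $B_{t,q}(k,d)=H_{t,q}(k,d)=0$ when the $N$ determined by $d=2RN+(q+1)R$ is not a nonnegative integer.) *)

theory Defs
  imports Complex_Main "HOL-Library.Poly_Mapping" "HOL-Library.Z2"
begin

text \<open>
  An exponent vector in \<open>\<nat>\<^sup>k\<close> is a finitely supported map \<open>nat \<Rightarrow>\<^sub>0 nat\<close> with support in
  \<open>{1..k}\<close>. The polynomial ring \<open>P\<^sub>k\<close> over the field with two elements sits inside the monoid ring
  of all such maps (countably many variables) as the polynomials whose monomials only use the
  variables \<open>1..k\<close>.
\<close>

type_synonym expvec = "nat \<Rightarrow>\<^sub>0 nat"
type_synonym f2poly = "expvec \<Rightarrow>\<^sub>0 bit"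

abbreviation "lookup \<equiv> Poly_Mapping.lookup"
abbreviation "keys \<equiv> Poly_Mapping.keys"

definition var :: "nat \<Rightarrow> f2poly" where
  "var i = Poly_Mapping.single (Poly_Mapping.single i 1) 1"

definition f2scale :: "bit \<Rightarrow> f2poly \<Rightarrow> f2poly" where
  "f2scale c p = Poly_Mapping.map ((*) c) p"

lemma lookup_f2scale [simp]: "lookup (f2scale c p) e = c * lookup p e"
  unfolding f2scale_def Poly_Mapping.map.rep_eq by (auto simp: when_def simp del: mult_bit_eq_and)

global_interpretation F2: vector_space f2scale
  by unfold_locales
    (rule poly_mapping_eqI, simp add: lookup_add distrib_left distrib_right mult.assoc
      del: mult_bit_eq_and add_bit_eq_xor)+

text \<open>
  Weak compositions of \<open>N\<close> into \<open>k\<close> parts; equally, the exponent vectors in \<open>\<nat>\<^sup>k\<close> of total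
  degree \<open>N\<close>, which label the degree-\<open>N\<close> monomials of \<open>P\<^sub>k\<close>.
\<close>

definition weak_compositions :: "nat \<Rightarrow> nat \<Rightarrow> expvec set" where
  "weak_compositions k N = {a. keys a \<subseteq> {1..k} \<and> (\<Sum>i=1..k. lookup a i) = N}"

definition Sq_monomial :: "nat \<Rightarrow> nat \<Rightarrow> expvec \<Rightarrow> f2poly" where
  "Sq_monomial k r a = (\<Sum>b\<in>weak_compositions k r.
     Poly_Mapping.single (a + b) (\<Prod>i=1..k. of_nat (lookup a i choose lookup b i)))"

definition Sq :: "nat \<Rightarrow> nat \<Rightarrow> f2poly \<Rightarrow> f2poly" where
  "Sq k r p = (\<Sum>a\<in>keys p. f2scale (lookup p a) (Sq_monomial k r a))"

definition g :: "nat \<Rightarrow> nat \<Rightarrow> expvec \<Rightarrow> nat set \<Rightarrow> f2poly" where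
  "g k R A J = (let m = 2 * R in
     (\<Prod>j\<in>J. var j ^ (m * lookup A j + R)) * (\<Prod>j\<in>{1..k} - J. var j ^ (m * lookup A j)))"

definition column_index :: "nat \<Rightarrow> nat \<Rightarrow> nat \<Rightarrow> (nat set \<times> expvec) set" where
  "column_index k q N = {J. J \<subseteq> {1..k} \<and> card J = q} \<times> weak_compositions k N"

definition column :: "nat \<Rightarrow> nat \<Rightarrow> nat set \<times> expvec \<Rightarrow> f2poly" where
  "column k R = (\<lambda>(J, A). Sq k R (g k R A J))"

text \<open>
  Undirected graphs are given by a vertex set and a set of two-element edges. A cycle is a cyclic
  sequence of at least three distinct vertices with consecutive ones adjacent.
\<close>

definition graph_cycle :: "'v set \<Rightarrow> 'v set set \<Rightarrow> 'v list \<Rightarrow> bool" where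
  "graph_cycle V E vs \<longleftrightarrow> set vs \<subseteq> V \<and> 3 \<le> length vs \<and> distinct vs \<and>
     (\<forall>i<length vs. {vs ! i, vs ! (Suc i mod length vs)} \<in> E)"

definition graph_forest :: "'v set \<Rightarrow> 'v set set \<Rightarrow> bool" where
  "graph_forest V E \<longleftrightarrow> \<not> (\<exists>vs. graph_cycle V E vs)"

text \<open>
  The incidence graph of a family \<open>(c\<^sub>i)\<close>, \<open>i \<in> F\<close>, of degree-\<open>d\<close> columns. Column vertices are the
  indices, so that members of a family with equal values would still be different vertices.
\<close>

definition incidence_verts :: "nat \<Rightarrow> nat \<Rightarrow> 'i set \<Rightarrow> ('i + expvec) set" where
  "incidence_verts k d F = Inl ` F \<union> Inr ` weak_compositions k d"

definition incidence_edges ::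
    "nat \<Rightarrow> nat \<Rightarrow> ('i \<Rightarrow> f2poly) \<Rightarrow> 'i set \<Rightarrow> ('i + expvec) set set" where
  "incidence_edges k d c F =
     {{Inl i, Inr e} | i e. i \<in> F \<and> e \<in> weak_compositions k d \<and> lookup (c i) e = 1}"

definition incidence_acyclic :: "nat \<Rightarrow> nat \<Rightarrow> ('i \<Rightarrow> f2poly) \<Rightarrow> 'i set \<Rightarrow> bool" where
  "incidence_acyclic k d c F \<longleftrightarrow>
     graph_forest (incidence_verts k d F) (incidence_edges k d c F)"

text \<open>
  \<open>B\<close> and \<open>H\<close> as functions of \<open>d\<close>: the number \<open>N\<close> is the one determined by
  \<open>d = 2 R N + (q + 1) R\<close> with \<open>R = 2\<^sup>t\<close>, and the value is \<open>0\<close> if there is none. For \<open>1 \<le> q \<le> s\<close>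
  none of the natural-number subtractions truncates.
\<close>

definition degree_eq :: "nat \<Rightarrow> nat \<Rightarrow> nat \<Rightarrow> nat \<Rightarrow> bool" where
  "degree_eq t q d N \<longleftrightarrow> d = 2 * 2 ^ t * N + (q + 1) * 2 ^ t"

definition B :: "nat \<Rightarrow> nat \<Rightarrow> nat \<Rightarrow> nat \<Rightarrow> nat" where
  "B t q k d = (if \<exists>N. degree_eq t q d N
     then let N = (THE N. degree_eq t q d N) in
       \<Sum>s=q..min k (N + q). ((s - 1) choose (q - 1)) * (k choose s) * ((N + q - 1) choose (s - 1))
     else 0)"

definition H :: "nat \<Rightarrow> nat \<Rightarrow> nat \<Rightarrow> nat \<Rightarrow> nat" where
  "H t q k d = (if \<exists>N. degree_eq t q d N
     then let N = (THE N. degree_eq t q d N) in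
       \<Sum>s=q..min k (N + q). (s - q + 1) * (k choose s) * ((N + q - 1) choose (s - 1))
     else 0)"

lemma degree_eq_the:
  assumes "degree_eq t q d N"
  shows "(THE N. degree_eq t q d N) = N"
  using assms by (auto simp: degree_eq_def intro!: the_equality)

lemma B_eq:
  assumes "degree_eq t q d N"
  shows "B t q k d = (\<Sum>s=q..min k (N + q).
    ((s - 1) choose (q - 1)) * (k choose s) * ((N + q - 1) choose (s - 1)))"
  using assms degree_eq_the[OF assms] by (auto simp: B_def Let_def)

lemma H_eq:
  assumes "degree_eq t q d N"
  shows "H t q k d = (\<Sum>s=q..min k (N + q).
    (s - q + 1) * (k choose s) * ((N + q - 1) choose (s - 1)))"
  using assms degree_eq_the[OF assms] by (auto simp: H_def Let_def)

end

theory Submission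
  imports Defs
begin

text \<open>
  The exponents of \<open>g(A;J)\<close> are multiples of \<open>R = 2\<^sup>t\<close>, and modulo 2 the binomials \<open>a choose b\<close>
  with \<open>0 < b < R\<close> vanish for such \<open>a\<close>. Hence \<open>Sq\<^sup>R\<close> can only raise one single exponent by \<open>R\<close>,
  and it does so with coefficient one exactly at the positions \<open>j \<in> J\<close>. In terms of the weight
  \<open>W = A + 1\<^sub>J\<close>, the monomials that appear have exponents \<open>R (2 W - 1\<^sub>K)\<close> with \<open>K = J - {j}\<close>, and
  such an exponent determines both \<open>W\<close> and \<open>K\<close>. The columns therefore split by weight into blocks
  without common monomials, and inside the block of \<open>W\<close> the column of \<open>J\<close> is the mod 2 boundary of
  the face \<open>J\<close> of the full simplex on the support of \<open>W\<close> (\<open>column_face_index\<close>).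

  For the rank, let the support have \<open>s\<close> elements and fix a vertex \<open>c\<close> in it. The faces that contain
  \<open>c\<close> have independent boundaries, because the facet \<open>J - {c}\<close> lies in the boundary of no other face
  through \<open>c\<close>. They span the rest, because the boundary of the cone with apex \<open>c\<close> over \<open>J\<close> is a cycle
  (\<open>boundary_cone\<close>). So a block contributes \<open>(s - 1) choose (q - 1)\<close> to the rank
  (\<open>dim_boundaries\<close>).

  For the forest, fix a set \<open>C\<close> of \<open>q - 1\<close> vertices in each support of size \<open>s \<ge> q\<close> and take the \<open>s - q + 1\<close> faces \<open>J\<close>
  containing \<open>C\<close>. Two of them share only the facet \<open>C\<close>, so that all other monomials are leaves, and
  each block is a tree around \<open>C\<close> (\<open>ex_acyclic_subfamily\<close>).

  In both cases it remains to add up over the weights, which are the weak compositions of \<open>N + q\<close>: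
  those with a support of size \<open>s\<close> number \<open>(k choose s) * ((N + q - 1) choose (s - 1))\<close>
  (\<open>card_weak_compositions_support\<close>).
\<close>

(* These rules turn arithmetic in the field with two elements into bit operations, which hides it
   from the ring simplification rules. *)
declare add_bit_eq_xor [simp del] mult_bit_eq_and [simp del]

section \<open>Counting exponent vectors by support\<close>

definition positive_compositions :: "nat set \<Rightarrow> nat \<Rightarrow> expvec set" where
  "positive_compositions S n = {a. keys a = S \<and> (\<Sum>i\<in>S. lookup a i) = n}"

lemma positive_compositions_0:
  "positive_compositions S 0 = (if S = {} then {0} else {})"
proof -
  have "S = {}" if "keys a = S" "(\<Sum>i\<in>S. lookup a i) = 0" for a :: expvec
  proof -
    have "finite S" using that(1) by auto
    with that(2) have "\<forall>i\<in>S. lookup a i = 0" by simp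
    with that(1) show ?thesis by (auto simp: in_keys_iff)
  qed
  then show ?thesis by (auto simp: positive_compositions_def)
qed

lemma positive_compositions_empty_Suc: "positive_compositions {} (Suc n) = {}"
  by (auto simp: positive_compositions_def)

text \<open>
  Lowering one fixed coordinate by one either leaves the support unchanged or removes that
  coordinate from it. On cardinalities this becomes Pascal's rule.
\<close>

lemma positive_compositions_Suc:
  assumes "finite S" "c \<in> S"
  shows "positive_compositions S (Suc n) =
    (\<lambda>a. a + Poly_Mapping.single c 1) `
      (positive_compositions S n \<union> positive_compositions (S - {c}) n)"
    (is "?L = ?f ` ?R")
proof (intro equalityI subsetI)
  fix a assume a: "a \<in> ?L"
  define b where "b = a - Poly_Mapping.single c 1"
  have ka: "keys a = S" and sa: "(\<Sum>i\<in>S. lookup a i) = Suc n"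
    using a by (auto simp: positive_compositions_def)
  have pos: "lookup a c \<ge> 1" using ka assms(2) by (auto simp: in_keys_iff)
  have ab: "a = ?f b"
    by (rule poly_mapping_eqI)
      (use pos in \<open>auto simp: b_def lookup_add lookup_minus lookup_single when_def\<close>)
  have "(\<Sum>i\<in>S. lookup a i) = (\<Sum>i\<in>S. lookup b i) + (\<Sum>i\<in>S. 1 when c = i)"
    by (subst ab) (simp add: lookup_add lookup_single sum.distrib)
  then have sb: "(\<Sum>i\<in>S. lookup b i) = n"
    using sa assms by (simp add: when_def)
  have off: "lookup b i = lookup a i" if "i \<noteq> c" for i
    using that by (simp add: b_def lookup_minus lookup_single when_def)
  have "b \<in> ?R"
  proof (cases "lookup b c = 0")
    case True
    then have "x \<in> keys b \<longleftrightarrow> x \<in> S - {c}" for x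
      using ka off[of x] by (cases "x = c") (auto simp: in_keys_iff)
    then have "keys b = S - {c}" by blast
    moreover have "(\<Sum>i\<in>S - {c}. lookup b i) = n"
      using sb True assms by (simp add: sum.remove)
    ultimately show ?thesis by (simp add: positive_compositions_def)
  next
    case False
    then have "keys b = S"
      using ka off assms(2) by (metis in_keys_iff subsetI subset_antisym)
    then show ?thesis using sb by (simp add: positive_compositions_def)
  qed
  then show "a \<in> ?f ` ?R" using ab by blast
next
  fix a assume "a \<in> ?f ` ?R"
  then obtain b where ab: "a = ?f b" and b: "b \<in> ?R" by blast
  have kb: "keys b = S \<or> keys b = S - {c}"
    using b by (auto simp: positive_compositions_def)
  have sb: "(\<Sum>i\<in>S. lookup b i) = n"
    using b
  proof
    assume b': "b \<in> positive_compositions (S - {c}) n"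
    then have "c \<notin> keys b" by (simp add: positive_compositions_def)
    then have "lookup b c = 0" by (simp add: in_keys_iff)
    with b' show ?thesis
      by (simp add: positive_compositions_def sum.remove[OF assms, of "lookup b"])
  qed (simp add: positive_compositions_def)
  have "keys a = S"
    using kb assms(2)
    by (auto simp: ab in_keys_iff lookup_add lookup_single when_def set_eq_iff split: if_splits)
  moreover have "(\<Sum>i\<in>S. lookup a i) = Suc n"
    using sb assms by (simp add: ab lookup_add lookup_single sum.distrib when_def)
  ultimately show "a \<in> ?L" by (simp add: positive_compositions_def)
qed

lemma card_positive_compositions:
  assumes "finite S"
  shows "finite (positive_compositions S n) \<and> card (positive_compositions S n) =
    (if S = {} then (if n = 0 then 1 else 0)
     else if n = 0 then 0 else (n - 1) choose (card S - 1))"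
  using assms
proof (induction n arbitrary: S)
  case 0
  then show ?case by (simp add: positive_compositions_0)
next
  case (Suc n)
  show ?case
  proof (cases "S = {}")
    case True
    then show ?thesis by (simp add: positive_compositions_empty_Suc)
  next
    case False
    then obtain c where c: "c \<in> S" by blast
    let ?X = "positive_compositions S n" and ?Y = "positive_compositions (S - {c}) n"
    have disj: "?X \<inter> ?Y = {}" using c by (auto simp: positive_compositions_def)
    have fin: "finite ?X" "finite ?Y" using Suc by auto
    have "card (positive_compositions S (Suc n)) = card (?X \<union> ?Y)"
      unfolding positive_compositions_Suc[OF Suc.prems c]
      by (rule card_image) (auto simp: inj_on_def)
    also have "\<dots> = card ?X + card ?Y" using fin disj by (simp add: card_Un_disjoint)
    also have "\<dots> = n choose (card S - 1)"
    proof -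
      have X: "card ?X = (if n = 0 then 0 else (n - 1) choose (card S - 1))"
        using Suc.IH[OF Suc.prems] False by simp
      have Y: "card ?Y = (if S - {c} = {} then (if n = 0 then 1 else 0)
          else if n = 0 then 0 else (n - 1) choose (card S - 2))"
        using Suc.IH[of "S - {c}"] Suc.prems c by (simp add: numeral_2_eq_2)
      show ?thesis
      proof (cases "S = {c}")
        case True
        with X Y show ?thesis by simp
      next
        case ne: False
        then have ne': "S - {c} \<noteq> {}" using c by blast
        then have "card (S - {c}) \<noteq> 0" using Suc.prems by (metis card_0_eq finite_Diff)
        then obtain r where r: "card S = Suc (Suc r)"
          using c Suc.prems by (metis card_Suc_Diff1 not0_implies_Suc)
        with X Y ne' show ?thesis by (cases n) auto
      qed
    qed
    finally show ?thesis
      using False fin unfolding positive_compositions_Suc[OF Suc.prems c] by simp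
  qed
qed

lemma weak_compositions_iff:
  "a \<in> weak_compositions k n \<longleftrightarrow> keys a \<subseteq> {1..k} \<and> a \<in> positive_compositions (keys a) n"
proof -
  have "(\<Sum>i=1..k. lookup a i) = (\<Sum>i\<in>keys a. lookup a i)" if "keys a \<subseteq> {1..k}"
    using that by (intro sum.mono_neutral_right) (auto simp: in_keys_iff)
  then show ?thesis by (auto simp: weak_compositions_def positive_compositions_def)
qed

lemma finite_weak_compositions [simp]: "finite (weak_compositions k n)"
proof (rule finite_subset)
  show "weak_compositions k n \<subseteq> (\<Union>S\<in>Pow {1..k}. positive_compositions S n)"
    unfolding weak_compositions_iff subset_iff by blast
  have "finite (positive_compositions S n)" if "S \<in> Pow {1..k}" for S
  proof -
    have "finite S" using that finite_subset[of S "{1..k}"] by simp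
    then show ?thesis by (simp add: card_positive_compositions)
  qed
  then show "finite (\<Union>S\<in>Pow {1..k}. positive_compositions S n)" by simp
qed

lemma card_keys_le_of_weak_composition:
  assumes "a \<in> weak_compositions k n"
  shows "card (keys a) \<le> min k n"
proof -
  have "card (keys a) \<le> k"
    using assms card_mono[of "{1..k}" "keys a"] by (auto simp: weak_compositions_def)
  moreover have "(\<Sum>i\<in>keys a. 1) \<le> (\<Sum>i\<in>keys a. lookup a i)"
    by (intro sum_mono) (auto simp: in_keys_iff Suc_le_eq)
  ultimately show ?thesis
    using assms by (auto simp: weak_compositions_iff positive_compositions_def)
qed

lemma card_weak_compositions_support:
  assumes "1 \<le> s" "1 \<le> n"
  shows "card {a \<in> weak_compositions k n. card (keys a) = s} =
    (k choose s) * ((n - 1) choose (s - 1))"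
proof -
  let ?I = "{S. S \<subseteq> {1..k} \<and> card S = s}"
  have eq: "{a \<in> weak_compositions k n. card (keys a) = s} =
      (\<Union>S\<in>?I. positive_compositions S n)"
  proof (intro equalityI subsetI)
    fix a assume "a \<in> {a \<in> weak_compositions k n. card (keys a) = s}"
    then show "a \<in> (\<Union>S\<in>?I. positive_compositions S n)"
      unfolding weak_compositions_iff by blast
  next
    fix a assume "a \<in> (\<Union>S\<in>?I. positive_compositions S n)"
    then obtain S where S: "S \<subseteq> {1..k}" "card S = s" "a \<in> positive_compositions S n" by blast
    then have "keys a = S" by (simp add: positive_compositions_def)
    with S show "a \<in> {a \<in> weak_compositions k n. card (keys a) = s}"
      by (simp add: weak_compositions_iff)
  qed
  have finS: "finite S" if "S \<in> ?I" for S
    using that finite_subset[of S "{1..k}"] by simp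
  have "card (\<Union>S\<in>?I. positive_compositions S n) = (\<Sum>S\<in>?I. card (positive_compositions S n))"
  proof (rule card_UN_disjoint)
    show "finite ?I" by simp
    show "\<forall>S\<in>?I. finite (positive_compositions S n)"
      using finS card_positive_compositions by blast
    show "\<forall>S\<in>?I. \<forall>T\<in>?I. S \<noteq> T \<longrightarrow> positive_compositions S n \<inter> positive_compositions T n = {}"
      by (auto simp: positive_compositions_def)
  qed
  also have "\<dots> = (\<Sum>S\<in>?I. (n - 1) choose (s - 1))"
  proof (rule sum.cong[OF refl])
    fix S assume S: "S \<in> ?I"
    then have "S \<noteq> {}" using assms by auto
    with S show "card (positive_compositions S n) = (n - 1) choose (s - 1)"
      using card_positive_compositions[OF finS[OF S], of n] assms by auto
  qed
  also have "\<dots> = (k choose s) * ((n - 1) choose (s - 1))"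
    by (simp add: n_subsets)
  finally show ?thesis unfolding eq .
qed

text \<open>
  Both the basis and the forest are built weight by weight, with a number of faces that depends only
  on the size of the support; this evaluates their total size.
\<close>

lemma card_Sigma_weak_compositions:
  assumes "1 \<le> q" "q \<le> n"
    and fin: "\<And>W. W \<in> weak_compositions k n \<Longrightarrow> finite (T W)"
    and small: "\<And>W. W \<in> weak_compositions k n \<Longrightarrow> card (keys W) < q \<Longrightarrow> T W = {}"
    and large: "\<And>W. W \<in> weak_compositions k n \<Longrightarrow> q \<le> card (keys W) \<Longrightarrow>
      card (T W) = f (card (keys W))"
  shows "card (Sigma (weak_compositions k n) T) =
    (\<Sum>s=q..min k n. f s * (k choose s) * ((n - 1) choose (s - 1)))"
proof -
  let ?W = "weak_compositions k n"
  let ?L = "{W \<in> ?W. q \<le> card (keys W)}"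
  have "card (Sigma ?W T) = (\<Sum>W\<in>?W. card (T W))"
    using fin by (simp add: card_SigmaI)
  also have "\<dots> = (\<Sum>W\<in>?L. f (card (keys W)))"
    by (rule sum.mono_neutral_cong_right) (auto simp: small large not_le)
  also have "\<dots> = (\<Sum>s=q..min k n. \<Sum>W | W \<in> ?L \<and> card (keys W) = s. f (card (keys W)))"
  proof (rule sum.group[symmetric])
    show "(\<lambda>W. card (keys W)) ` ?L \<subseteq> {q..min k n}"
      by (auto dest: card_keys_le_of_weak_composition)
  qed simp_all
  also have "\<dots> = (\<Sum>s=q..min k n. f s * (k choose s) * ((n - 1) choose (s - 1)))"
  proof (rule sum.cong[OF refl])
    fix s assume s: "s \<in> {q..min k n}"
    then have "{W. W \<in> ?L \<and> card (keys W) = s} = {W \<in> ?W. card (keys W) = s}" by auto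
    with s assms show "(\<Sum>W | W \<in> ?L \<and> card (keys W) = s. f (card (keys W))) =
        f s * (k choose s) * ((n - 1) choose (s - 1))"
      using card_weak_compositions_support[of s n k] by simp
  qed
  finally show ?thesis .
qed

section \<open>Columns as simplicial boundaries\<close>

definition indicator_exp :: "nat set \<Rightarrow> expvec" where
  "indicator_exp J = (\<Sum>j\<in>J. Poly_Mapping.single j 1)"

lemma lookup_indicator_exp:
  "finite J \<Longrightarrow> lookup (indicator_exp J) i = (if i \<in> J then 1 else 0)"
  by (simp add: indicator_exp_def lookup_sum lookup_single when_def)

text \<open>
  The exponent vector of the monomial that stands for the face \<open>K\<close> of the simplex on the support of
  \<open>W\<close>. Outside the support it vanishes even at points of \<open>K\<close>, by truncated subtraction.
\<close>

definition face_exp :: "nat \<Rightarrow> expvec \<Rightarrow> nat set \<Rightarrow> expvec" where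
  "face_exp R W K = Poly_Mapping.mapp (\<lambda>i w. R * (2 * w - (if i \<in> K then 1 else 0))) W"

lemma lookup_face_exp:
  "lookup (face_exp R W K) i = R * (2 * lookup W i - (if i \<in> K then 1 else 0))"
  by (auto simp: face_exp_def lookup_mapp when_def in_keys_iff)

text \<open>
  After division by \<open>R\<close> the parity of a coordinate reveals whether it lies in the face, and rounding
  up recovers the weight. Thus different weights and different faces never share a monomial.
\<close>

lemma face_exp_eq_iff:
  assumes "R > 0" "K \<subseteq> keys W" "K' \<subseteq> keys W'"
  shows "face_exp R W K = face_exp R W' K' \<longleftrightarrow> W = W' \<and> K = K'"
proof
  assume eq: "face_exp R W K = face_exp R W' K'"
  have "lookup W i = lookup W' i \<and> (i \<in> K \<longleftrightarrow> i \<in> K')" for i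
  proof -
    have "2 * lookup W i - (if i \<in> K then 1 else 0) = 2 * lookup W' i - (if i \<in> K' then 1 else 0)"
      using arg_cong[OF eq, of "\<lambda>e. lookup e i"] assms(1) by (simp add: lookup_face_exp)
    moreover have "i \<in> K \<Longrightarrow> lookup W i > 0" "i \<in> K' \<Longrightarrow> lookup W' i > 0"
      using assms(2,3) by (auto simp: in_keys_iff subset_iff)
    ultimately show ?thesis
      by (cases "i \<in> K"; cases "i \<in> K'"; simp; presburger)
  qed
  then show "W = W' \<and> K = K'" by (auto intro: poly_mapping_eqI)
qed simp

definition boundary :: "nat \<Rightarrow> expvec \<Rightarrow> nat set \<Rightarrow> f2poly" where
  "boundary R W J = (\<Sum>j\<in>J. Poly_Mapping.single (face_exp R W (J - {j})) 1)"

lemma lookup_boundary_nonzero: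
  assumes "lookup (boundary R W J) e \<noteq> 0"
  shows "\<exists>j\<in>J. e = face_exp R W (J - {j})"
proof (rule ccontr)
  assume "\<not> ?thesis"
  then have "lookup (boundary R W J) e = 0"
    by (auto simp: boundary_def lookup_sum lookup_single when_def intro!: sum.neutral)
  with assms show False by simp
qed

lemma lookup_boundary_facet:
  assumes "R > 0" "J \<subseteq> keys W" "c \<in> J"
  shows "lookup (boundary R W J) (face_exp R W (J - {c})) = 1"
proof -
  have "finite J" using assms(2) by (rule finite_subset) simp
  have "face_exp R W (J - {j}) = face_exp R W (J - {c}) \<longleftrightarrow> j = c" if "j \<in> J" for j
  proof -
    have sub: "J - {i} \<subseteq> keys W" for i using assms(2) by blast
    have "J - {j} = J - {c} \<longleftrightarrow> j = c" using that assms(3) by blast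
    then show ?thesis using face_exp_eq_iff[OF assms(1) sub sub] by simp
  qed
  then have "lookup (boundary R W J) (face_exp R W (J - {c})) = (\<Sum>j\<in>J. if j = c then 1 else 0)"
    by (auto simp: boundary_def lookup_sum lookup_single when_def intro!: sum.cong)
  with \<open>finite J\<close> assms(3) show ?thesis by simp
qed

lemma f2poly_add_self: "p + p = (0 :: f2poly)"
proof (rule poly_mapping_eqI)
  fix e
  have "x + x = 0" for x :: bit by (cases x) simp_all
  then show "lookup (p + p) e = lookup 0 e" by (simp only: lookup_add lookup_zero)
qed

text \<open>
  Removing two vertices in either order gives the same face, so every term occurs twice and cancels
  in characteristic two.
\<close>

lemma boundary_boundary:
  assumes "finite L"
  shows "(\<Sum>i\<in>L. boundary R W (L - {i})) = 0"
proof -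
  let ?h = "\<lambda>i j. Poly_Mapping.single (face_exp R W (L - {i} - {j})) (1 :: bit)"
  have split: "boundary R W (L - {i}) =
      (\<Sum>j\<in>L. if j < i then ?h i j else 0) + (\<Sum>j\<in>L. if i < j then ?h i j else 0)"
    if "i \<in> L" for i
  proof -
    have "boundary R W (L - {i}) = (\<Sum>j\<in>L. if j \<noteq> i then ?h i j else 0)"
      unfolding boundary_def using assms by (intro sum.mono_neutral_cong_left) auto
    also have "\<dots> = (\<Sum>j\<in>L. (if j < i then ?h i j else 0) + (if i < j then ?h i j else 0))"
      by (rule sum.cong) auto
    finally show ?thesis by (simp only: sum.distrib)
  qed
  have swap: "(\<Sum>i\<in>L. \<Sum>j\<in>L. if i < j then ?h i j else 0) =
      (\<Sum>i\<in>L. \<Sum>j\<in>L. if j < i then ?h i j else 0)"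
    by (subst sum.swap, intro sum.cong refl if_cong) (metis Diff_insert Diff_insert2 insert_commute)
  have "(\<Sum>i\<in>L. boundary R W (L - {i})) =
      (\<Sum>i\<in>L. \<Sum>j\<in>L. if j < i then ?h i j else 0) + (\<Sum>i\<in>L. \<Sum>j\<in>L. if i < j then ?h i j else 0)"
    by (simp only: split sum.distrib cong: sum.cong)
  then show ?thesis unfolding swap f2poly_add_self .
qed

text \<open>
  This is \<open>boundary_boundary\<close> for the cone \<open>insert c J\<close>: its facet \<open>J\<close> is the only one that avoids \<open>c\<close>.
\<close>

lemma boundary_cone:
  assumes "finite J" "c \<notin> J"
  shows "boundary R W J = (\<Sum>j\<in>J. boundary R W (insert c (J - {j})))"
proof -
  have "0 = (\<Sum>i\<in>insert c J. boundary R W (insert c J - {i}))"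
    using boundary_boundary[of "insert c J"] assms(1) by simp
  also have "\<dots> = boundary R W J + (\<Sum>j\<in>J. boundary R W (insert c J - {j}))"
    using assms by simp
  also have "(\<Sum>j\<in>J. boundary R W (insert c J - {j})) =
      (\<Sum>j\<in>J. boundary R W (insert c (J - {j})))"
    using assms(2) by (intro sum.cong refl arg_cong[where f = "boundary R W"]) auto
  finally have "boundary R W J + (\<Sum>j\<in>J. boundary R W (insert c (J - {j}))) =
      boundary R W J + boundary R W J"
    by (simp add: f2poly_add_self)
  then show ?thesis by simp
qed

section \<open>The top Steenrod square on the monomials\<close>

text \<open>
  By absorption \<open>b * (a choose b)\<close> is a multiple of \<open>a\<close>, while \<open>b\<close> has fewer than \<open>t\<close> factors of two.
\<close>

lemma even_binomial_of_dvd: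
  fixes a b t :: nat
  assumes "2 ^ t dvd a" "0 < b" "b < 2 ^ t"
  shows "even (a choose b)"
proof (rule ccontr)
  assume odd: "odd (a choose b)"
  have "b * (a choose b) = a * ((a - 1) choose (b - 1))"
    by (rule times_binomial_minus1_eq) fact
  with assms(1) have "2 ^ t dvd b * (a choose b)" by simp
  with odd have "2 ^ t dvd b"
    by (simp add: coprime_dvd_mult_left_iff)
  with assms(2,3) show False by (meson dvd_imp_le not_less)
qed

text \<open>
  The case of Lucas' theorem that governs the top square: \<open>\<epsilon>\<close> is the binary digit of
  \<open>2\<^sup>t (2a + \<epsilon>)\<close> at position \<open>t\<close>, and all lower digits are zero.
\<close>

lemma odd_binomial_iff:
  fixes a b t :: nat
  assumes "0 < b" "b \<le> 2 ^ t" "\<epsilon> \<in> {0, 1}"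
  shows "odd ((2 ^ t * (2 * a + \<epsilon>)) choose b) \<longleftrightarrow> b = 2 ^ t \<and> \<epsilon> = 1"
proof (cases "b = 2 ^ t")
  case False
  with assms even_binomial_of_dvd[of t "2 ^ t * (2 * a + \<epsilon>)" b] show ?thesis by simp
next
  case b: True
  have ev: "even ((2 ^ t * (2 * a)) choose (2 ^ t))"
  proof -
    have "2 ^ t * ((2 ^ t * (2 * a)) choose (2 ^ t)) =
        2 ^ t * (2 * (a * ((2 ^ t * (2 * a) - 1) choose (2 ^ t - 1))))"
      using times_binomial_minus1_eq[of "2 ^ t" "2 ^ t * (2 * a)"] by simp
    then show ?thesis by simp
  qed
  have "odd ((2 ^ t * (2 * a + 1)) choose (2 ^ t))"
  proof -
    (* By Vandermonde, splitting off the digit 2^t; only the term for j = 0 is odd. *)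
    let ?h = "\<lambda>j. ((2 ^ t * (2 * a)) choose j) * ((2 ^ t) choose (2 ^ t - j))"
    have "(2 ^ t * (2 * a + 1)) choose (2 ^ t) = (\<Sum>j\<le>2 ^ t. ?h j)"
      by (simp only: vandermonde distrib_left mult_1_right)
    also have "\<dots> = ?h 0 + (\<Sum>j\<in>{..2 ^ t} - {0}. ?h j)"
      by (rule sum.remove) auto
    finally have eq: "(2 ^ t * (2 * a + 1)) choose (2 ^ t) = 1 + (\<Sum>j\<in>{..2 ^ t} - {0}. ?h j)"
      by simp
    have "even (?h j)" if "j \<in> {..2 ^ t} - {0}" for j
    proof (cases "j = 2 ^ t")
      case True
      with ev show ?thesis by simp
    next
      case False
      with that even_binomial_of_dvd[of t "2 ^ t * (2 * a)" j] show ?thesis by simp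
    qed
    then have "even (\<Sum>j\<in>{..2 ^ t} - {0}. ?h j)" by (rule dvd_sum)
    with eq show ?thesis by simp
  qed
  with ev b assms(3) show ?thesis by auto
qed

lemma var_power: "var i ^ n = Poly_Mapping.single (Poly_Mapping.single i n) 1"
  by (induction n) (simp_all add: var_def mult_single flip: single_add)

lemma prod_var_power:
  "finite I \<Longrightarrow> (\<Prod>i\<in>I. var i ^ f i) =
    Poly_Mapping.single (\<Sum>i\<in>I. Poly_Mapping.single i (f i)) 1"
  by (induction I rule: finite_induct) (simp_all add: var_power mult_single)

definition g_exp :: "nat \<Rightarrow> expvec \<Rightarrow> nat set \<Rightarrow> expvec" where
  "g_exp R A J = Poly_Mapping.mapp (\<lambda>_ w. 2 * R * w) A + (\<Sum>j\<in>J. Poly_Mapping.single j R)"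

lemma lookup_g_exp:
  "finite J \<Longrightarrow> lookup (g_exp R A J) i = R * (2 * lookup A i + (if i \<in> J then 1 else 0))"
  by (auto simp: g_exp_def lookup_add lookup_mapp lookup_sum lookup_single when_def in_keys_iff)

lemma g_eq_single:
  assumes "J \<subseteq> {1..k}" "keys A \<subseteq> {1..k}"
  shows "g k R A J = Poly_Mapping.single (g_exp R A J) 1"
proof -
  have fin: "finite J" using assms(1) by (rule finite_subset) simp
  have "(\<Sum>j\<in>J. Poly_Mapping.single j (2 * R * lookup A j + R)) +
      (\<Sum>j\<in>{1..k} - J. Poly_Mapping.single j (2 * R * lookup A j)) = g_exp R A J" (is "?s = _")
  proof (rule poly_mapping_eqI)
    fix i
    have "i \<notin> {1..k} \<Longrightarrow> lookup A i = 0" using assms(2) by (auto simp: in_keys_iff)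
    then show "lookup ?s i = lookup (g_exp R A J) i"
      using fin assms(1)
      by (auto simp: lookup_add lookup_sum lookup_single when_def lookup_g_exp algebra_simps)
  qed
  then show ?thesis
    using fin by (simp add: g_def Let_def prod_var_power mult_single)
qed

lemma Sq_single: "Sq k r (Poly_Mapping.single a 1) = Sq_monomial k r a"
  by (simp add: Sq_def)

text \<open>
  An odd coefficient forces every nonzero \<open>b\<^sub>i\<close> to equal \<open>R\<close>; since their sum is \<open>R\<close>, there is just one.
\<close>

lemma Sq_coefficient:
  assumes R: "R = 2 ^ t" and J: "J \<subseteq> {1..k}" and b: "b \<in> weak_compositions k R"
  shows "(\<Prod>i=1..k. of_nat (lookup (g_exp R A J) i choose lookup b i)) =
    (if \<exists>j\<in>J. b = Poly_Mapping.single j R then 1 else (0 :: bit))"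
proof -
  have fin: "finite J" using J by (rule finite_subset) simp
  have R0: "R > 0" using R by simp
  have of_nat: "(of_nat n :: bit) = (if odd n then 1 else 0)" for n :: nat
    by (induction n) (auto simp: add_bit_eq_xor)
  have odd: "odd (lookup (g_exp R A J) i choose n) \<longleftrightarrow> n = R \<and> i \<in> J"
    if "0 < n" "n \<le> R" for i n
    using odd_binomial_iff[of n t "if i \<in> J then 1 else 0" "lookup A i"] that fin R
    by (auto simp: lookup_g_exp)
  have sum: "(\<Sum>i=1..k. lookup b i) = R" and kb: "keys b \<subseteq> {1..k}"
    using b by (auto simp: weak_compositions_def)
  show ?thesis
  proof (cases "\<exists>j\<in>J. b = Poly_Mapping.single j R")
    case True
    then obtain j where j: "j \<in> J" "b = Poly_Mapping.single j R" by blast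
    have "(of_nat (lookup (g_exp R A J) i choose lookup b i) :: bit) = 1" for i
      using odd[of R j] R0 j by (cases "i = j") (auto simp: of_nat lookup_single)
    with True show ?thesis by simp
  next
    case False
    have "\<exists>j\<in>{1..k}. lookup b j \<noteq> 0"
      using sum R0 by (metis not_gr_zero sum.neutral)
    then obtain j where j: "j \<in> {1..k}" "lookup b j > 0" by auto
    have le: "lookup b j + (\<Sum>i\<in>{1..k} - {j}. lookup b i) = R"
      using sum j by (simp add: sum.remove)
    have "(of_nat (lookup (g_exp R A J) j choose lookup b j) :: bit) = 0"
    proof (rule ccontr)
      assume "\<not> ?thesis"
      then have jR: "lookup b j = R" "j \<in> J"
        using odd[of "lookup b j" j] j le by (auto simp: of_nat split: if_splits)
      with le have "\<forall>i\<in>{1..k} - {j}. lookup b i = 0" by simp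
      then have "b = Poly_Mapping.single j R"
        using kb jR by (intro poly_mapping_eqI) (auto simp: lookup_single when_def in_keys_iff)
      with False jR show False by blast
    qed
    then have "(\<Prod>i=1..k. of_nat (lookup (g_exp R A J) i choose lookup b i)) = (0 :: bit)"
      using j(1) by (intro prod_zero) auto
    with False show ?thesis by simp
  qed
qed

text \<open>
  Raising the exponent at \<open>j \<in> J\<close> from \<open>2RA\<^sub>j + R\<close> to \<open>2R(A\<^sub>j + 1)\<close> clears the odd multiple of \<open>R\<close> at
  \<open>j\<close> and thereby removes \<open>j\<close> from the face, while the weight \<open>A + 1\<^sub>J\<close> stays the same.
\<close>

lemma column_eq_boundary:
  assumes R: "R = 2 ^ t" and JA: "(J, A) \<in> column_index k q N"
  shows "column k R (J, A) = boundary R (A + indicator_exp J) J"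
proof -
  have J: "J \<subseteq> {1..k}" and A: "keys A \<subseteq> {1..k}"
    using JA by (auto simp: column_index_def weak_compositions_def)
  have fin: "finite J" using J by (rule finite_subset) simp
  have R0: "R > 0" using R by simp
  let ?a = "g_exp R A J"
  let ?S = "(\<lambda>j. Poly_Mapping.single j R) ` J"
  have S: "?S \<subseteq> weak_compositions k R"
    using J by (auto simp: weak_compositions_def lookup_single when_def split: if_splits)
  have "column k R (J, A) = Sq_monomial k R ?a"
    by (simp add: column_def g_eq_single[OF J A] Sq_single)
  also have "\<dots> = (\<Sum>b\<in>?S. Poly_Mapping.single (?a + b) 1)"
    unfolding Sq_monomial_def
  proof (rule sum.mono_neutral_cong_right[OF _ S])
    show "\<forall>b\<in>weak_compositions k R - ?S. Poly_Mapping.single (?a + b)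
        (\<Prod>i=1..k. of_nat (lookup ?a i choose lookup b i) :: bit) = 0"
      using Sq_coefficient[OF R J] by (auto simp: image_iff)
    show "Poly_Mapping.single (?a + b) (\<Prod>i=1..k. of_nat (lookup ?a i choose lookup b i) :: bit) =
        Poly_Mapping.single (?a + b) 1" if "b \<in> ?S" for b
    proof -
      have "b \<in> weak_compositions k R" "\<exists>j\<in>J. b = Poly_Mapping.single j R"
        using that S by auto
      then show ?thesis using Sq_coefficient[OF R J, of b A] by simp
    qed
  qed simp
  also have "\<dots> = (\<Sum>j\<in>J. Poly_Mapping.single (?a + Poly_Mapping.single j R) 1)"
  proof (subst sum.reindex)
    show "inj_on (\<lambda>j. Poly_Mapping.single j R) J"
      using R0 by (intro inj_onI) (metis lookup_single_eq lookup_single_not_eq not_less0)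
  qed simp
  also have "\<dots> = boundary R (A + indicator_exp J) J"
    unfolding boundary_def
  proof (intro sum.cong refl arg_cong2[where f = Poly_Mapping.single] poly_mapping_eqI)
    fix j i assume "j \<in> J"
    then show "lookup (?a + Poly_Mapping.single j R) i =
        lookup (face_exp R (A + indicator_exp J) (J - {j})) i"
      using fin by (auto simp: lookup_add lookup_single when_def lookup_g_exp lookup_face_exp
          lookup_indicator_exp algebra_simps)
  qed
  finally show ?thesis .
qed

section \<open>Regrouping the columns by weight\<close>

definition weighted_faces :: "nat \<Rightarrow> nat \<Rightarrow> nat \<Rightarrow> (expvec \<times> nat set) set" where
  "weighted_faces k q n =
    (SIGMA W:weak_compositions k n. {J. J \<subseteq> keys W \<and> card J = q})"

definition face_index :: "expvec \<times> nat set \<Rightarrow> nat set \<times> expvec" where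
  "face_index = (\<lambda>(W, J). (J, W - indicator_exp J))"

lemma minus_indicator_exp_add:
  fixes W :: expvec
  assumes "J \<subseteq> keys W"
  shows "W - indicator_exp J + indicator_exp J = W"
proof -
  have "finite J" using assms by (rule finite_subset) simp
  then show ?thesis
    using assms
    by (intro poly_mapping_eqI) (auto simp: lookup_add lookup_minus lookup_indicator_exp in_keys_iff)
qed

lemma bij_betw_face_index:
  "bij_betw face_index (weighted_faces k q (N + q)) (column_index k q N)"
proof (rule bij_betw_byWitness[where f' = "\<lambda>(J, A). (A + indicator_exp J, J)"])
  have sum_ind: "(\<Sum>i=1..k. lookup (indicator_exp J) i) = card J" if "J \<subseteq> {1..k}" for J
  proof -
    have "finite J" using that by (rule finite_subset) simp
    then have "(\<Sum>i=1..k. lookup (indicator_exp J) i) = (\<Sum>i=1..k. if i \<in> J then 1 else 0)"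
      by (simp add: lookup_indicator_exp)
    also have "\<dots> = card J" using that by (simp add: sum.If_cases Int_absorb1)
    finally show ?thesis .
  qed
  show "\<forall>x\<in>weighted_faces k q (N + q).
      (\<lambda>(J, A). (A + indicator_exp J, J)) (face_index x) = x"
    by (auto simp: weighted_faces_def face_index_def minus_indicator_exp_add)
  show "\<forall>x\<in>column_index k q N. face_index ((\<lambda>(J, A). (A + indicator_exp J, J)) x) = x"
    by (auto simp: face_index_def)
  show "face_index ` weighted_faces k q (N + q) \<subseteq> column_index k q N"
  proof clarsimp
    fix W J assume "(W, J) \<in> weighted_faces k q (N + q)"
    then have W: "keys W \<subseteq> {1..k}" "(\<Sum>i=1..k. lookup W i) = N + q" and J: "J \<subseteq> keys W" "card J = q"
      by (auto simp: weighted_faces_def weak_compositions_def)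
    have Jk: "J \<subseteq> {1..k}" using W J by blast
    have "(\<Sum>i=1..k. lookup (W - indicator_exp J + indicator_exp J) i) = N + q"
      using W J by (simp add: minus_indicator_exp_add)
    then have "(\<Sum>i=1..k. lookup (W - indicator_exp J) i) = N"
      using sum_ind[OF Jk] J by (simp add: lookup_add sum.distrib)
    moreover have "keys (W - indicator_exp J) \<subseteq> {1..k}"
      using W by (auto simp: in_keys_iff lookup_minus subset_iff)
    ultimately show "face_index (W, J) \<in> column_index k q N"
      using Jk J by (simp add: face_index_def column_index_def weak_compositions_def)
  qed
  show "(\<lambda>(J, A). (A + indicator_exp J, J)) ` column_index k q N \<subseteq> weighted_faces k q (N + q)"
  proof clarsimp
    fix J A assume "(J, A) \<in> column_index k q N"
    then have J: "J \<subseteq> {1..k}" "card J = q"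
      and A: "keys A \<subseteq> {1..k}" "(\<Sum>i=1..k. lookup A i) = N"
      by (auto simp: column_index_def weak_compositions_def)
    have fin: "finite J" using J(1) by (rule finite_subset) simp
    have "keys (A + indicator_exp J) \<subseteq> {1..k}"
      using A J fin by (auto simp: in_keys_iff lookup_add lookup_indicator_exp subset_iff split: if_splits)
    moreover have "J \<subseteq> keys (A + indicator_exp J)"
      using fin by (auto simp: in_keys_iff lookup_add lookup_indicator_exp)
    ultimately show "(A + indicator_exp J, J) \<in> weighted_faces k q (N + q)"
      using A J sum_ind[OF J(1)]
      by (simp add: weighted_faces_def weak_compositions_def lookup_add sum.distrib)
  qed
qed

lemma column_face_index:
  assumes "R = 2 ^ t" "(W, J) \<in> weighted_faces k q (N + q)"
  shows "column k R (face_index (W, J)) = boundary R W J"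
proof -
  have "face_index (W, J) \<in> column_index k q N"
    using bij_betw_face_index assms(2) by (rule bij_betwE[rule_format])
  moreover have "J \<subseteq> keys W" using assms(2) by (auto simp: weighted_faces_def)
  ultimately show ?thesis
    using column_eq_boundary[OF assms(1)] by (simp add: face_index_def minus_indicator_exp_add)
qed

section \<open>The rank\<close>

lemma independent_of_private_monomials:
  assumes "finite I"
    and one: "\<And>i. i \<in> I \<Longrightarrow> lookup (v i) (m i) = 1"
    and zero: "\<And>i i'. i \<in> I \<Longrightarrow> i' \<in> I \<Longrightarrow> i' \<noteq> i \<Longrightarrow> lookup (v i') (m i) = 0"
  shows "inj_on v I \<and> F2.independent (v ` I)"
proof
  show inj: "inj_on v I"
    using one zero by (metis inj_onI zero_neq_one)
  show "F2.independent (v ` I)"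
  proof (rule F2.independent_if_scalars_zero)
    show "finite (v ` I)" using assms(1) by simp
  next
    fix f x assume sum: "(\<Sum>x\<in>v ` I. f2scale (f x) x) = 0" and "x \<in> v ` I"
    then obtain i where i: "i \<in> I" "x = v i" by blast
    have "0 = lookup (\<Sum>y\<in>v ` I. f2scale (f y) y) (m i)" by (simp add: sum)
    also have "\<dots> = (\<Sum>i'\<in>I. f (v i') * lookup (v i') (m i))"
      by (simp add: lookup_sum sum.reindex[OF inj])
    also have "\<dots> = (\<Sum>i'\<in>I. if i' = i then f (v i) else 0)"
      using one zero i by (intro sum.cong) auto
    also have "\<dots> = f x" using i assms(1) by simp
    finally show "f x = 0" by simp
  qed
qed

text \<open>
  The smallest element of the support serves as the vertex \<open>c\<close> whose star gives the basis.
\<close>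

lemma dim_boundaries:
  assumes R: "R > 0" and q: "1 \<le> q"
  shows "F2.dim ((\<lambda>(W, J). boundary R W J) ` weighted_faces k q (N + q)) =
    (\<Sum>s=q..min k (N + q). ((s - 1) choose (q - 1)) * (k choose s) * ((N + q - 1) choose (s - 1)))"
proof -
  define T where "T W = {J. J \<subseteq> keys W \<and> card J = q \<and> Min (keys W) \<in> J}" for W :: expvec
  define D where "D = Sigma (weak_compositions k (N + q)) T"
  let ?bd = "\<lambda>(W, J). boundary R W J"
  let ?V = "?bd ` weighted_faces k q (N + q)"
  have finT: "finite (T W)" for W
    unfolding T_def by (rule finite_subset[of _ "Pow (keys W)"]) auto
  have finD: "finite D" unfolding D_def by (intro finite_SigmaI finite_weak_compositions finT)
  have "inj_on ?bd D \<and> F2.independent (?bd ` D)"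
  proof (rule independent_of_private_monomials[OF finD,
        where m = "\<lambda>(W, J). face_exp R W (J - {Min (keys W)})"])
    fix x assume "x \<in> D"
    then show "lookup (?bd x) ((\<lambda>(W, J). face_exp R W (J - {Min (keys W)})) x) = 1"
      using R by (auto simp: D_def T_def intro: lookup_boundary_facet)
  next
    fix x y assume x: "x \<in> D" and y: "y \<in> D" and ne: "y \<noteq> x"
    obtain W J where xJ: "x = (W, J)" by fastforce
    obtain W' J' where yJ: "y = (W', J')" by fastforce
    have J: "J \<subseteq> keys W" "Min (keys W) \<in> J" using x by (auto simp: xJ D_def T_def)
    have J': "J' \<subseteq> keys W'" "Min (keys W') \<in> J'" using y by (auto simp: yJ D_def T_def)
    have "lookup (boundary R W' J') (face_exp R W (J - {Min (keys W)})) = 0"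
    proof (rule ccontr)
      assume "\<not> ?thesis"
      then obtain j where j: "j \<in> J'"
        "face_exp R W (J - {Min (keys W)}) = face_exp R W' (J' - {j})"
        by (meson lookup_boundary_nonzero)
      have "J - {Min (keys W)} \<subseteq> keys W" "J' - {j} \<subseteq> keys W'" using J J' by auto
      with j(2) have eq: "W = W'" "J - {Min (keys W)} = J' - {j}"
        using face_exp_eq_iff[OF R] by auto
      with J' have "j = Min (keys W)" by blast
      with eq J j(1) have "J = J'" by blast
      with eq ne show False by (simp add: xJ yJ)
    qed
    then show "lookup (?bd y) ((\<lambda>(W, J). face_exp R W (J - {Min (keys W)})) x) = 0"
      by (simp add: xJ yJ)
  qed
  then have inj: "inj_on ?bd D" and ind: "F2.independent (?bd ` D)" by auto
  have "?V \<subseteq> F2.span (?bd ` D)"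
  proof clarsimp
    fix W J assume "(W, J) \<in> weighted_faces k q (N + q)"
    then have W: "W \<in> weak_compositions k (N + q)" and J: "J \<subseteq> keys W" "card J = q"
      by (auto simp: weighted_faces_def)
    have fin: "finite J" using J(1) by (rule finite_subset) simp
    have "J \<noteq> {}" using J(2) q by auto
    then have c: "Min (keys W) \<in> keys W" using J(1) by (intro Min_in) auto
    have base: "boundary R W L \<in> F2.span (?bd ` D)" if "L \<in> T W" for L
      using that W by (intro F2.span_base) (force simp: D_def)
    show "boundary R W J \<in> F2.span (?bd ` D)"
    proof (cases "Min (keys W) \<in> J")
      case True
      with J show ?thesis by (intro base) (simp add: T_def)
    next
      case False
      have "insert (Min (keys W)) (J - {j}) \<in> T W" if "j \<in> J" for j
      proof -
        have "card (insert (Min (keys W)) (J - {j})) = Suc (card (J - {j}))"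
          using False fin by simp
        also have "\<dots> = q" using that fin J(2) q by simp
        finally show ?thesis using c J(1) by (auto simp: T_def)
      qed
      then have "(\<Sum>j\<in>J. boundary R W (insert (Min (keys W)) (J - {j}))) \<in> F2.span (?bd ` D)"
        by (intro F2.span_sum base)
      then show ?thesis using boundary_cone[OF fin False] by simp
    qed
  qed
  moreover have "D \<subseteq> weighted_faces k q (N + q)"
    by (auto simp: D_def T_def weighted_faces_def)
  ultimately have "F2.span (?bd ` D) = F2.span ?V"
    by (subst F2.span_eq) (blast intro: F2.span_base)
  then have "F2.dim ?V = card (?bd ` D)" using ind by (rule F2.dim_eq_card)
  also have "\<dots> = card D" using inj by (rule card_image)
  also have "\<dots> = (\<Sum>s=q..min k (N + q).
      ((s - 1) choose (q - 1)) * (k choose s) * ((N + q - 1) choose (s - 1)))"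
    unfolding D_def
  proof (rule card_Sigma_weak_compositions[OF q _ finT])
    fix W :: expvec
    show "T W = {}" if "card (keys W) < q"
    proof -
      have "q \<le> card (keys W)" if "J \<in> T W" for J
        using that card_mono[of "keys W" J] by (auto simp: T_def)
      with that show ?thesis by fastforce
    qed
    assume le: "q \<le> card (keys W)"
    let ?c = "Min (keys W)" and ?P = "{K. K \<subseteq> keys W - {Min (keys W)} \<and> card K = q - 1}"
    have "keys W \<noteq> {}" using le q by auto
    then have c: "?c \<in> keys W" by (intro Min_in) auto
    have "T W = insert ?c ` ?P"
    proof (intro equalityI subsetI)
      fix J assume "J \<in> T W"
      then have J: "J \<subseteq> keys W" "card J = q" "?c \<in> J" by (auto simp: T_def)
      then have "J - {?c} \<in> ?P" by (auto simp: finite_subset[OF J(1)])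
      moreover have "J = insert ?c (J - {?c})" using J(3) by blast
      ultimately show "J \<in> insert ?c ` ?P" by blast
    next
      fix J assume "J \<in> insert ?c ` ?P"
      then obtain K where K: "K \<subseteq> keys W - {?c}" "card K = q - 1" "J = insert ?c K" by blast
      have "finite K" using K(1) by (rule finite_subset) simp
      moreover have "?c \<notin> K" using K(1) by blast
      ultimately have "card J = q" using K q by simp
      with K c show "J \<in> T W" by (auto simp: T_def)
    qed
    moreover have "inj_on (insert ?c) ?P" by (rule inj_onI) blast
    ultimately have "card (T W) = card ?P" by (simp add: card_image)
    also have "\<dots> = (card (keys W) - 1) choose (q - 1)"
      using c by (simp add: n_subsets)
    finally show "card (T W) = (card (keys W) - 1) choose (q - 1)" .
  qed simp
  finally show ?thesis .
qed

section \<open>The acyclic subfamily\<close>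

lemma graph_cycle_two_neighbours:
  assumes cyc: "graph_cycle V E vs" and v: "v \<in> set vs"
  shows "\<exists>x\<in>set vs. \<exists>y\<in>set vs. x \<noteq> y \<and> {v, x} \<in> E \<and> {v, y} \<in> E"
proof -
  let ?n = "length vs"
  have n: "3 \<le> ?n" and dist: "distinct vs"
    and edge: "\<And>i. i < ?n \<Longrightarrow> {vs ! i, vs ! (Suc i mod ?n)} \<in> E"
    using cyc by (auto simp: graph_cycle_def)
  obtain i where i: "i < ?n" "v = vs ! i" using v by (metis in_set_conv_nth)
  define p where "p = (if i = 0 then ?n - 1 else i - 1)"
  define r where "r = Suc i mod ?n"
  have p: "p < ?n" "Suc p mod ?n = i" using i n by (auto simp: p_def)
  have r: "r < ?n" unfolding r_def using n by (intro mod_less_divisor) linarith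
  have "r \<noteq> p" using i n by (cases "Suc i = ?n") (auto simp: p_def r_def)
  then have "vs ! r \<noteq> vs ! p" using dist p r by (simp add: nth_eq_iff_index_eq)
  moreover have "{v, vs ! r} \<in> E" using edge[OF i(1)] by (simp add: i r_def)
  moreover have "{v, vs ! p} \<in> E" using edge[OF p(1)] p(2) by (simp add: i insert_commute)
  ultimately show ?thesis using p r by (meson nth_mem)
qed

text \<open>
  A cycle enters and leaves a column \<open>i\<close> through two different monomials. One of them differs from
  \<open>z i\<close>, hence is a leaf and cannot lie on a cycle.
\<close>

lemma incidence_acyclic_of_leaves:
  assumes leaf: "\<And>i i' e. i \<in> F \<Longrightarrow> i' \<in> F \<Longrightarrow> lookup (col i) e = 1 \<Longrightarrow> lookup (col i') e = 1 \<Longrightarrow>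
    e \<noteq> z i \<Longrightarrow> i' = i"
  shows "incidence_acyclic k d col F"
  unfolding incidence_acyclic_def graph_forest_def
proof
  assume "\<exists>vs. graph_cycle (incidence_verts k d F) (incidence_edges k d col F) vs"
  then obtain vs where cyc: "graph_cycle (incidence_verts k d F) (incidence_edges k d col F) vs" ..
  let ?E = "incidence_edges k d col F"
  note nbrs = graph_cycle_two_neighbours[OF cyc]
  have Inl_edge: "\<exists>e. x = Inr e \<and> i \<in> F \<and> lookup (col i) e = 1" if "{Inl i, x} \<in> ?E" for i x
    using that by (auto simp: incidence_edges_def doubleton_eq_iff)
  have Inr_edge: "\<exists>i. x = Inl i \<and> i \<in> F \<and> lookup (col i) e = 1" if "{Inr e, x} \<in> ?E" for e x
    using that by (auto simp: incidence_edges_def doubleton_eq_iff)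
  have "\<exists>i. Inl i \<in> set vs"
  proof -
    have "vs \<noteq> []" using cyc by (auto simp: graph_cycle_def)
    then have hd: "hd vs \<in> set vs" by simp
    then obtain x where "x \<in> set vs" "{hd vs, x} \<in> ?E" using nbrs by blast
    with hd show ?thesis using Inr_edge by (metis sumE)
  qed
  then obtain i where i: "Inl i \<in> set vs" ..
  obtain e e' where e: "Inr e \<in> set vs" "lookup (col i) e = 1"
    and e': "Inr e' \<in> set vs" "lookup (col i) e' = 1" and "e \<noteq> e'" and iF: "i \<in> F"
    using nbrs[OF i] Inl_edge by metis
  then obtain u where u: "Inr u \<in> set vs" "lookup (col i) u = 1" "u \<noteq> z i" by metis
  obtain i1 i2 where "i1 \<in> F" "lookup (col i1) u = 1" "i2 \<in> F" "lookup (col i2) u = 1" "i1 \<noteq> i2"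
    using nbrs[OF u(1)] Inr_edge by metis
  with leaf[OF iF _ u(2) _ u(3)] show False by metis
qed

lemma ex_acyclic_subfamily:
  assumes R: "R = 2 ^ t" and q: "1 \<le> q"
  shows "\<exists>F. F \<subseteq> column_index k q N \<and>
    card F = (\<Sum>s=q..min k (N + q).
      (s - q + 1) * (k choose s) * ((N + q - 1) choose (s - 1))) \<and>
    incidence_acyclic k d (column k R) F"
proof -
  have R0: "R > 0" using R by simp
  have "\<exists>C. C \<subseteq> keys W \<and> card C = q - 1" if "q \<le> card (keys W)" for W :: expvec
    using that by (meson diff_le_self le_trans obtain_subset_with_card_n)
  then obtain C where C: "\<And>W :: expvec. q \<le> card (keys W) \<Longrightarrow> C W \<subseteq> keys W \<and> card (C W) = q - 1"
    by metis
  define T where "T W = {J. J \<subseteq> keys W \<and> card J = q \<and> C W \<subseteq> J}" for W :: expvec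
  define D where "D = Sigma (weak_compositions k (N + q)) T"
  have D_sub: "D \<subseteq> weighted_faces k q (N + q)"
    by (auto simp: D_def T_def weighted_faces_def)
  have finT: "finite (T W)" for W
    unfolding T_def by (rule finite_subset[of _ "Pow (keys W)"]) auto
  have card_ge: "q \<le> card (keys W)" if "J \<in> T W" for W J
    using that card_mono[of "keys W" J] by (auto simp: T_def)
  have "card D = (\<Sum>s=q..min k (N + q). (s - q + 1) * (k choose s) * ((N + q - 1) choose (s - 1)))"
    unfolding D_def
  proof (rule card_Sigma_weak_compositions[OF q _ finT])
    fix W :: expvec
    show "T W = {}" if "card (keys W) < q" using that card_ge by force
    assume le: "q \<le> card (keys W)"
    have CW: "C W \<subseteq> keys W" "card (C W) = q - 1" using C[OF le] by auto
    have finC: "finite (C W)" using CW(1) by (rule finite_subset) simp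
    have "T W = (\<lambda>x. insert x (C W)) ` (keys W - C W)"
    proof (intro equalityI subsetI)
      fix J assume "J \<in> T W"
      then have J: "J \<subseteq> keys W" "card J = q" "C W \<subseteq> J" by (auto simp: T_def)
      then have "card (J - C W) = 1" using CW finC q by (simp add: card_Diff_subset)
      then obtain x where x: "J - C W = {x}" by (auto simp: card_1_singleton_iff)
      with J have "J = insert x (C W)" "x \<in> keys W - C W" by blast+
      then show "J \<in> (\<lambda>x. insert x (C W)) ` (keys W - C W)" by blast
    next
      fix J assume "J \<in> (\<lambda>x. insert x (C W)) ` (keys W - C W)"
      then show "J \<in> T W" using CW finC q by (auto simp: T_def)
    qed
    moreover have "inj_on (\<lambda>x. insert x (C W)) (keys W - C W)" by (rule inj_onI) blast
    ultimately have "card (T W) = card (keys W - C W)" by (simp add: card_image)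
    also have "\<dots> = card (keys W) - q + 1" using CW finC q le by (simp add: card_Diff_subset)
    finally show "card (T W) = card (keys W) - q + 1" .
  qed simp
  moreover have "card (face_index ` D) = card D"
    using inj_on_subset[OF bij_betw_imp_inj_on[OF bij_betw_face_index] D_sub] by (rule card_image)
  moreover have "face_index ` D \<subseteq> column_index k q N"
    using bij_betw_imp_surj_on[OF bij_betw_face_index] D_sub by blast
  moreover have "incidence_acyclic k d (column k R) (face_index ` D)"
  proof (rule incidence_acyclic_of_leaves[where
        z = "\<lambda>(J, A). face_exp R (A + indicator_exp J) (C (A + indicator_exp J))"])
    fix i i' e
    assume "i \<in> face_index ` D" "i' \<in> face_index ` D"
      and one: "lookup (column k R i) e = 1" "lookup (column k R i') e = 1"
      and ne: "e \<noteq> (\<lambda>(J, A). face_exp R (A + indicator_exp J) (C (A + indicator_exp J))) i"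
    then obtain W J W' J' where i: "i = face_index (W, J)" and D: "(W, J) \<in> D"
      and i': "i' = face_index (W', J')" and D': "(W', J') \<in> D" by fastforce
    have J: "J \<in> T W" and J': "J' \<in> T W'" using D D' by (auto simp: D_def)
    have sub: "J \<subseteq> keys W" "J' \<subseteq> keys W'" using J J' by (auto simp: T_def)
    have ne': "e \<noteq> face_exp R W (C W)"
      using ne sub by (simp add: i face_index_def minus_indicator_exp_add)
    have "lookup (boundary R W J) e \<noteq> 0" "lookup (boundary R W' J') e \<noteq> 0"
      using one column_face_index[OF R] D D' D_sub by (auto simp: i i')
    then obtain j j' where j: "j \<in> J" "e = face_exp R W (J - {j})"
      and j': "j' \<in> J'" "e = face_exp R W' (J' - {j'})"
      by (meson lookup_boundary_nonzero)
    have "J - {j} \<subseteq> keys W" "J' - {j'} \<subseteq> keys W'" using sub by auto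
    with j j' have W: "W = W'" and K: "J - {j} = J' - {j'}"
      using face_exp_eq_iff[OF R0] by auto
    (* The face L is recovered from any of its facets other than C W, which makes them leaves. *)
    have union: "L = C W \<union> (L - {l})" if L: "L \<in> T W" "l \<in> L" "L - {l} \<noteq> C W" for L l
    proof -
      have LW: "L \<subseteq> keys W" "card L = q" "C W \<subseteq> L" using L by (auto simp: T_def)
      have "finite L" using LW(1) by (rule finite_subset) simp
      have "l \<in> C W"
      proof (rule ccontr)
        assume "l \<notin> C W"
        then have "C W \<subseteq> L - {l}" using LW by blast
        moreover have "card (C W) = card (L - {l})"
          using C[OF card_ge[OF L(1)]] L(2) LW \<open>finite L\<close> by simp
        ultimately have "C W = L - {l}" using \<open>finite L\<close> by (simp add: card_subset_eq)
        with L(3) show False by simp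
      qed
      with LW show ?thesis by blast
    qed
    have facet: "J - {j} \<noteq> C W" using ne' j(2) by metis
    have J'W: "J' \<in> T W" using J' W by simp
    have "J = C W \<union> (J - {j})" using J j(1) facet by (rule union)
    also have "\<dots> = J'" unfolding K using union[OF J'W j'(1)] facet K by simp
    finally have "J = J'" .
    with W show "i' = i" by (simp add: i i')
  qed
  ultimately show ?thesis by metis
qed

theorem theorem4p7:
  fixes k t R q N d :: nat
  assumes "k \<ge> 1" and "R = 2 ^ t" and "1 \<le> q" and "q \<le> k"
    and "d = 2 * R * N + (q + 1) * R"
  shows "F2.dim (column k R ` column_index k q N) = B t q k d \<and>
         B t q k d = (\<Sum>s=q..min k (N + q).
           ((s - 1) choose (q - 1)) * (k choose s) * ((N + q - 1) choose (s - 1))) \<and>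
         (q \<ge> 2 \<longrightarrow>
           (\<exists>F. F \<subseteq> column_index k q N \<and> card F = H t q k d \<and>
             incidence_acyclic k d (column k R) F)) \<and>
         H t q k d = (\<Sum>s=q..min k (N + q).
           (s - q + 1) * (k choose s) * ((N + q - 1) choose (s - 1)))"
proof -
  have deg: "degree_eq t q d N" using assms by (simp add: degree_eq_def)
  have "column k R ` column_index k q N = column k R ` face_index ` weighted_faces k q (N + q)"
    using bij_betw_imp_surj_on[OF bij_betw_face_index] by metis
  also have "\<dots> = (\<lambda>(W, J). boundary R W J) ` weighted_faces k q (N + q)"
    unfolding image_image by (rule image_cong) (auto simp: column_face_index[OF assms(2)])
  finally have "F2.dim (column k R ` column_index k q N) = B t q k d"
    using dim_boundaries[of R q k N] assms(2,3) B_eq[OF deg] by simp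
  then show ?thesis
    using B_eq[OF deg] H_eq[OF deg] ex_acyclic_subfamily[OF assms(2,3), of k N d] by metis
qed

end
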